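(* Let $n\ge k\ge 0$ be integers and $a,b,c$ real numbers, and write $z=1-x-y$. At all real $(x,y)$ with $x\ne 1$ the following hold: $$(2n+a+b+c+2)\,x\,P_{n,k}^{(a,b,c)}=(n-k+a)P_{n,k}^{(a-1,b,c)}+(n-k+1)P_{n+1,k}^{(a-1,b,c)},$$ $$\begin{aligned} (2k+b+c+1)(2n+a+b+c+2)\,y\,P_{n,k}^{(a,b,c)}&=(k+b)(n+k+b+c+1)P_{n,k}^{(a,b-1,c)}\\ &\quad-(k+1)(n-k+a)P_{n,k+1}^{(a,b-1,c)}\\ &\quad-(k+b)(n-k+1)P_{n+1,k}^{(a,b-1,c)}\\ &\quad+(k+1)(n+k+a+b+c+2)P_{n+1,k+1}^{(a,b-1,c)}, \end{aligned}$$ $$\begin{aligned} (2k+b+c+1)(2n+a+b+c+2)\,z\,P_{n,k}^{(a,b,c)}&=(k+c)(n+k+b+c+1)P_{n,k}^{(a,b,c-1)}\\ &\quad+(k+1)(n-k+a)P_{n,k+1}^{(a,b,c-1)}\\ &\quad-(k+c)(n-k+1)P_{n+1,k}^{(a,b,c-1)}\\ &\quad-(k+1)(n+k+a+b+c+2)P_{n+1,k+1}^{(a,b,c-1)}. \end{aligned}$$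
   Context: Jacobi polynomials: for an integer $m\ge 0$ and real $\alpha,\beta$, $P_m^{(\alpha,\beta)}(x)=\sum_{s=0}^m\binom{m+\alpha}{m-s}\binom{m+\beta}{s}\left(\frac{x-1}{2}\right)^s\left(\frac{x+1}{2}\right)^{m-s}$ (generalized binomial coefficients), and $P_{-1}^{(\alpha,\beta)}=0$. Shifted Jacobi polynomials: $\tilde P_m^{(\alpha,\beta)}(x)=P_m^{(\alpha,\beta)}(2x-1)$. For real $a,b,c$ and integers $n,k$, at points with $x\ne1$, $$P_{n,k}^{(a,b,c)}(x,y)=\tilde P_{n-k}^{(2k+b+c+1,a)}(x)\,(1-x)^k\,\tilde P_k^{(c,b)}\!\left(\tfrac{y}{1-x}\right)\qquad (n\ge k\ge 0),$$ and $P_{n,k}^{(a,b,c)}=0$ whenever $k=-1$ or $n-k=-1$. *)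

theory Defs
  imports Complex_Main
begin

text \<open>
  Degrees and indices are integers, so that the convention \<open>P\<^sub>-\<^sub>1 = 0\<close> can be expressed;
  every negative degree is given the value 0.
\<close>

definition jacobi :: "int \<Rightarrow> real \<Rightarrow> real \<Rightarrow> real \<Rightarrow> real" where
  "jacobi m \<alpha> \<beta> x =
     (if m < 0 then 0
      else (\<Sum>s\<le>nat m. ((of_int m + \<alpha>) gchoose (nat m - s)) * ((of_int m + \<beta>) gchoose s)
              * ((x - 1) / 2) ^ s * ((x + 1) / 2) ^ (nat m - s)))"

definition shifted_jacobi :: "int \<Rightarrow> real \<Rightarrow> real \<Rightarrow> real \<Rightarrow> real" where
  "shifted_jacobi m \<alpha> \<beta> x = jacobi m \<alpha> \<beta> (2 * x - 1)"

text \<open>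
  Only meaningful at points with \<open>x \<noteq> 1\<close>, because of the quotient \<open>y / (1 - x)\<close>.
\<close>

definition triangle_jacobi ::
    "int \<Rightarrow> int \<Rightarrow> real \<Rightarrow> real \<Rightarrow> real \<Rightarrow> real \<Rightarrow> real \<Rightarrow> real" where
  "triangle_jacobi n k a b c x y =
     (if k < 0 \<or> n - k < 0 then 0
      else shifted_jacobi (n - k) (2 * of_int k + b + c + 1) a x * (1 - x) ^ nat k
             * shifted_jacobi k c b (y / (1 - x)))"

end

theory Submission
  imports Defs "HOL-Computational_Algebra.Formal_Power_Series"
begin

text \<open>
  The shifted Jacobi polynomial of degree \<open>m\<close> is the coefficient of \<open>X ^ m\<close> in
  \<open>(1 + (x - 1) X) powr (m + \<beta>) * (1 + x X) powr (m + \<alpha>)\<close>. Pascal's rule and the derivative of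
  such a product yield recurrences for its coefficients, which combine, using \<open>x - (x - 1) = 1\<close>,
  to three contiguity relations: multiplication by \<open>x\<close> lowers \<open>\<beta>\<close>, multiplication by \<open>1 - x\<close>
  lowers \<open>\<alpha>\<close>, and no multiplication raises \<open>\<alpha>\<close>. With \<open>w = y / (1 - x)\<close> one has
  \<open>y = (1 - x) w\<close> and \<open>z = (1 - x) (1 - w)\<close>. The relations in \<open>w\<close> split the product into two
  terms; in the one of degree \<open>k\<close> the factor \<open>1 - x\<close> is absorbed by lowering the first parameter,
  in the one of degree \<open>k + 1\<close> it is kept in the power \<open>(1 - x) ^ (k + 1)\<close> and the first
  parameter is raised.
\<close>

section \<open>Formal binomial series and the coefficients of their products\<close>

definition binomial_fps :: "real \<Rightarrow> real \<Rightarrow> real fps" where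
  "binomial_fps u a = Abs_fps (\<lambda>n. (a gchoose n) * u ^ n)"

lemma binomial_fps_nth [simp]: "fps_nth (binomial_fps u a) n = (a gchoose n) * u ^ n"
  by (simp add: binomial_fps_def)

text \<open>Pascal's rule, read as multiplication of the series by \<open>1 + u X\<close>.\<close>

lemma binomial_fps_add_one:
  "binomial_fps u (a + 1) = binomial_fps u a + fps_const u * (fps_X * binomial_fps u a)"
proof (rule fps_ext)
  fix n
  show "fps_nth (binomial_fps u (a + 1)) n
      = fps_nth (binomial_fps u a + fps_const u * (fps_X * binomial_fps u a)) n"
    by (cases n) (simp_all add: gbinomial_Suc_Suc distrib_left distrib_right mult_ac)
qed

lemma fps_deriv_binomial_fps:
  "fps_deriv (binomial_fps u a) = fps_const (a * u) * binomial_fps u (a - 1)"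
proof (rule fps_ext)
  fix n
  show "fps_nth (fps_deriv (binomial_fps u a)) n = fps_nth (fps_const (a * u) * binomial_fps u (a - 1)) n"
    using gbinomial_absorption[of n a] by (simp add: algebra_simps)
qed

text \<open>The exponent \<open>a\<close> belongs to \<open>v\<close> and \<open>b\<close> to
  \<open>u\<close>. Keeping \<open>u\<close> and \<open>v\<close> independent makes the roles
  interchangeable; the Jacobi case is \<open>u = x - 1\<close>, \<open>v = x\<close>.\<close>

definition binomial_coeff :: "real \<Rightarrow> real \<Rightarrow> nat \<Rightarrow> real \<Rightarrow> real \<Rightarrow> real" where
  "binomial_coeff u v m a b = fps_nth (binomial_fps u b * binomial_fps v a) m"

lemma binomial_coeff_0 [simp]: "binomial_coeff u v 0 a b = 1"
  by (simp add: binomial_coeff_def)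

lemma binomial_coeff_Suc_add_one_left:
  "binomial_coeff u v (Suc m) (a + 1) b
   = binomial_coeff u v (Suc m) a b + v * binomial_coeff u v m a b"
proof -
  have "binomial_fps u b * binomial_fps v (a + 1)
      = binomial_fps u b * binomial_fps v a
        + fps_const v * (fps_X * (binomial_fps u b * binomial_fps v a))"
    unfolding binomial_fps_add_one by (simp add: algebra_simps)
  then show ?thesis
    by (simp add: binomial_coeff_def)
qed

lemma binomial_coeff_commute: "binomial_coeff u v m a b = binomial_coeff v u m b a"
  by (simp add: binomial_coeff_def mult.commute)

lemma binomial_coeff_Suc_add_one_right:
  "binomial_coeff u v (Suc m) a (b + 1)
   = binomial_coeff u v (Suc m) a b + u * binomial_coeff u v m a b"
  using binomial_coeff_Suc_add_one_left[of v u m b a] by (simp add: binomial_coeff_commute[of v u])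

lemma binomial_coeff_deriv:
  "(real m + 1) * binomial_coeff u v (Suc m) a b
   = a * v * binomial_coeff u v m (a - 1) b + b * u * binomial_coeff u v m a (b - 1)"
proof -
  have "fps_deriv (binomial_fps u b * binomial_fps v a)
      = fps_const (a * v) * (binomial_fps u b * binomial_fps v (a - 1))
        + fps_const (b * u) * (binomial_fps u (b - 1) * binomial_fps v a)"
    by (simp add: fps_deriv_binomial_fps algebra_simps del: fps_const_mult)
  then have "fps_nth (fps_deriv (binomial_fps u b * binomial_fps v a)) m
      = fps_nth (fps_const (a * v) * (binomial_fps u b * binomial_fps v (a - 1))
        + fps_const (b * u) * (binomial_fps u (b - 1) * binomial_fps v a)) m"
    by simp
  then show ?thesis
    by (simp add: binomial_coeff_def fps_deriv_nth add.commute del: fps_deriv_mult)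
qed

text \<open>For \<open>v = u + 1\<close> one has \<open>v (1 + u X) = 1 + u (1 + v X)\<close>;
  multiply by the two series and compare coefficients.\<close>

lemma binomial_coeff_exchange:
  assumes "v - u = 1"
  shows "v * binomial_coeff u v m a (b + 1)
    = binomial_coeff u v m a b + u * binomial_coeff u v m (a + 1) b"
proof (cases m)
  case 0
  then show ?thesis using assms by simp
next
  case (Suc k)
  have v: "v = u + 1" using assms by simp
  show ?thesis
    unfolding Suc binomial_coeff_Suc_add_one_left binomial_coeff_Suc_add_one_right
    by (simp add: v algebra_simps)
qed

text \<open>The derivative rule at \<open>(a + 1, b)\<close> and the exchange rule at
  \<open>(a, b - 1)\<close> share the term
  \<open>b * u * binomial_coeff u v m (a + 1) (b - 1)\<close>; eliminating it leaves this
  relation.\<close>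

lemma binomial_coeff_times_right:
  assumes "v - u = 1"
  shows "(a + b + 1) * (v * binomial_coeff u v m a b)
    = b * binomial_coeff u v m a (b - 1) + (real m + 1) * binomial_coeff u v (Suc m) (a + 1) b"
proof -
  have "b * (v * binomial_coeff u v m a b)
      = b * (binomial_coeff u v m a (b - 1) + u * binomial_coeff u v m (a + 1) (b - 1))"
    using binomial_coeff_exchange[OF assms, of m a "b - 1"] by simp
  then show ?thesis
    using binomial_coeff_deriv[of m u v "a + 1" b] by (simp add: algebra_simps)
qed

text \<open>The same elimination at \<open>(a, b + 1)\<close> and \<open>(a - 1, b)\<close>; here
  the shared term is \<open>a * v * binomial_coeff u v m (a - 1) (b + 1)\<close>.\<close>

lemma binomial_coeff_times_left:
  assumes "v - u = 1"
  shows "(a + b + 1) * (- u * binomial_coeff u v m a b)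
    = a * binomial_coeff u v m (a - 1) b - (real m + 1) * binomial_coeff u v (Suc m) a (b + 1)"
proof -
  have "a * (v * binomial_coeff u v m (a - 1) (b + 1))
      = a * (binomial_coeff u v m (a - 1) b + u * binomial_coeff u v m a b)"
    using binomial_coeff_exchange[OF assms, of m "a - 1" b] by simp
  then show ?thesis
    using binomial_coeff_deriv[of m u v a "b + 1"] by (simp add: algebra_simps)
qed

section \<open>Contiguity relations of shifted Jacobi polynomials\<close>

lemma shifted_jacobi_eq_binomial_coeff:
  assumes "0 \<le> m"
  shows "shifted_jacobi m \<alpha> \<beta> x = binomial_coeff (x - 1) x (nat m) (of_int m + \<alpha>) (of_int m + \<beta>)"
proof -
  have "(2 * x - 1 - 1) / 2 = x - 1" "(2 * x - 1 + 1) / 2 = x"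
    by (simp_all add: field_simps)
  then have "shifted_jacobi m \<alpha> \<beta> x
      = (\<Sum>s\<le>nat m. ((of_int m + \<alpha>) gchoose (nat m - s)) * ((of_int m + \<beta>) gchoose s)
          * (x - 1) ^ s * x ^ (nat m - s))"
    using assms by (simp only: shifted_jacobi_def jacobi_def not_less[symmetric] if_False)
  then show ?thesis
    unfolding binomial_coeff_def fps_mult_nth by (simp add: atLeast0AtMost mult_ac)
qed

lemma shifted_jacobi_neg: "m < 0 \<Longrightarrow> shifted_jacobi m \<alpha> \<beta> x = 0"
  by (simp add: shifted_jacobi_def jacobi_def)

text \<open>The exponents contain the degree: passing to \<open>m + 1\<close> and
  \<open>\<beta> - 1\<close> raises the exponent of \<open>1 + x X\<close> by one and keeps the
  other, as in \<open>binomial_coeff_times_right\<close>.\<close>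

lemma shifted_jacobi_times_x:
  assumes "0 \<le> m"
  shows "(2 * of_int m + \<alpha> + \<beta> + 1) * (x * shifted_jacobi m \<alpha> \<beta> x)
    = (of_int m + \<beta>) * shifted_jacobi m \<alpha> (\<beta> - 1) x
      + (of_int m + 1) * shifted_jacobi (m + 1) \<alpha> (\<beta> - 1) x"
  using assms binomial_coeff_times_right[of x "x - 1" "of_int m + \<alpha>" "of_int m + \<beta>" "nat m"]
  by (simp add: shifted_jacobi_eq_binomial_coeff nat_add_distrib algebra_simps)

lemma shifted_jacobi_times_one_minus_x:
  assumes "0 \<le> m"
  shows "(2 * of_int m + \<alpha> + \<beta> + 1) * ((1 - x) * shifted_jacobi m \<alpha> \<beta> x)
    = (of_int m + \<alpha>) * shifted_jacobi m (\<alpha> - 1) \<beta> x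
      - (of_int m + 1) * shifted_jacobi (m + 1) (\<alpha> - 1) \<beta> x"
  using assms binomial_coeff_times_left[of x "x - 1" "of_int m + \<alpha>" "of_int m + \<beta>" "nat m"]
  by (simp add: shifted_jacobi_eq_binomial_coeff nat_add_distrib algebra_simps)

text \<open>Pascal's rule and \<open>binomial_coeff_times_right\<close> in degree
  \<open>m - 1\<close> both contain \<open>x * binomial_coeff (x - 1) x (nat (m - 1)) A B\<close>
  with \<open>A = m + \<alpha>\<close> and \<open>B = m + \<beta>\<close>; eliminating it removes
  the factor \<open>x\<close>.\<close>

lemma shifted_jacobi_raise:
  assumes "0 \<le> m"
  shows "(2 * of_int m + \<alpha> + \<beta> + 1) * shifted_jacobi m \<alpha> \<beta> x
    = (of_int m + \<alpha> + \<beta> + 1) * shifted_jacobi m (\<alpha> + 1) \<beta> x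
      - (of_int m + \<beta>) * shifted_jacobi (m - 1) (\<alpha> + 1) \<beta> x"
proof (cases "m = 0")
  case True
  \<comment> \<open>In degree 0 the last term vanishes by the convention for negative degrees, and
    both remaining polynomials are 1.\<close>
  then show ?thesis
    by (simp add: shifted_jacobi_eq_binomial_coeff shifted_jacobi_neg)
next
  case False
  define k where "k = nat (m - 1)"
  have m: "m = int (Suc k)" using False assms by (simp add: k_def)
  define A B where "A = real k + 1 + \<alpha>" and "B = real k + 1 + \<beta>"
  have P: "shifted_jacobi m \<alpha> \<beta> x = binomial_coeff (x - 1) x (Suc k) A B"
    "shifted_jacobi m (\<alpha> + 1) \<beta> x = binomial_coeff (x - 1) x (Suc k) (A + 1) B"
    "shifted_jacobi (m - 1) (\<alpha> + 1) \<beta> x = binomial_coeff (x - 1) x k A (B - 1)"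
    by (simp_all add: shifted_jacobi_eq_binomial_coeff m A_def B_def nat_add_distrib algebra_simps)
  have c: "2 * of_int m + \<alpha> + \<beta> + 1 = A + B + 1"
    "of_int m + \<alpha> + \<beta> + 1 = A + B + 1 - (real k + 1)" "of_int m + \<beta> = B"
    by (simp_all add: m A_def B_def)
  have "(A + B + 1) * (x * binomial_coeff (x - 1) x k A B)
      = B * binomial_coeff (x - 1) x k A (B - 1)
        + (real k + 1) * binomial_coeff (x - 1) x (Suc k) (A + 1) B"
    by (rule binomial_coeff_times_right) simp
  moreover have "(A + B + 1) * binomial_coeff (x - 1) x (Suc k) (A + 1) B
      = (A + B + 1) * (binomial_coeff (x - 1) x (Suc k) A B + x * binomial_coeff (x - 1) x k A B)"
    by (simp add: binomial_coeff_Suc_add_one_left)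
  ultimately show ?thesis
    unfolding P c left_diff_distrib by (simp only: distrib_left)
qed

section \<open>The three identities on the triangle\<close>

lemma triangle_jacobi_eq:
  assumes "0 \<le> k"
  shows "triangle_jacobi n k a b c x y
    = shifted_jacobi (n - k) (2 * of_int k + b + c + 1) a x * (1 - x) ^ nat k
      * shifted_jacobi k c b (y / (1 - x))"
  \<comment> \<open>For \<open>n < k\<close> the first factor has negative degree and is 0. This
    covers \<open>triangle_jacobi n (k + 1)\<close> when \<open>k = n\<close>.\<close>
  using assms by (simp add: triangle_jacobi_def shifted_jacobi_neg)

theorem corollary4:
  fixes n k :: int and a b c x y z :: real
  assumes "0 \<le> k" and "k \<le> n"
    and "x \<noteq> 1"
    and "z = 1 - x - y"
  shows "(2 * of_int n + a + b + c + 2) * x * triangle_jacobi n k a b c x y =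
           (of_int n - of_int k + a) * triangle_jacobi n k (a - 1) b c x y
         + (of_int n - of_int k + 1) * triangle_jacobi (n + 1) k (a - 1) b c x y
    \<and> (2 * of_int k + b + c + 1) * (2 * of_int n + a + b + c + 2) * y
             * triangle_jacobi n k a b c x y =
           (of_int k + b) * (of_int n + of_int k + b + c + 1)
             * triangle_jacobi n k a (b - 1) c x y
         - (of_int k + 1) * (of_int n - of_int k + a)
             * triangle_jacobi n (k + 1) a (b - 1) c x y
         - (of_int k + b) * (of_int n - of_int k + 1)
             * triangle_jacobi (n + 1) k a (b - 1) c x y
         + (of_int k + 1) * (of_int n + of_int k + a + b + c + 2)
             * triangle_jacobi (n + 1) (k + 1) a (b - 1) c x y
    \<and> (2 * of_int k + b + c + 1) * (2 * of_int n + a + b + c + 2) * z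
             * triangle_jacobi n k a b c x y =
           (of_int k + c) * (of_int n + of_int k + b + c + 1)
             * triangle_jacobi n k a b (c - 1) x y
         + (of_int k + 1) * (of_int n - of_int k + a)
             * triangle_jacobi n (k + 1) a b (c - 1) x y
         - (of_int k + c) * (of_int n - of_int k + 1)
             * triangle_jacobi (n + 1) k a b (c - 1) x y
         - (of_int k + 1) * (of_int n + of_int k + a + b + c + 2)
             * triangle_jacobi (n + 1) (k + 1) a b (c - 1) x y"
proof -
  define m where "m = n - k"
  \<comment> \<open>\<open>\<alpha>\<close> has two roles: it is the first parameter of the factor
    in \<open>x\<close>, and it is the prefactor \<open>2 k + c + b + 1\<close> of the relations in
    \<open>w\<close>. \<open>N\<close> below is the corresponding prefactor in
    \<open>x\<close>.\<close>
  define \<alpha> where "\<alpha> = 2 * of_int k + b + c + 1"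
  define w where "w = y / (1 - x)"
  define q where "q = (1 - x) ^ nat k"
  define N where "N = 2 * of_int n + a + b + c + 2"
  define P where "P = shifted_jacobi m \<alpha> a x"
  define Q where "Q = shifted_jacobi k c b w"
  have m0: "0 \<le> m" using assms by (simp add: m_def)
  have y: "y = (1 - x) * w"
    using assms by (simp add: w_def)
  have z: "z = (1 - x) * (1 - w)"
    using assms(4) y by (simp add: right_diff_distrib)
  have N_eq: "2 * of_int m + \<alpha> + a + 1 = N"
    by (simp add: m_def \<alpha>_def N_def)
  have power: "(1 - x) ^ nat (k + 1) = (1 - x) * q"
    using assms by (simp add: q_def nat_add_distrib)
  have coeffs: "of_int m + \<alpha> = of_int n + of_int k + b + c + 1"
    "of_int m + \<alpha> + a + 1 = of_int n + of_int k + a + b + c + 2"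
    "of_int m + a = of_int n - of_int k + a" "of_int m + 1 = of_int n - of_int k + (1 :: real)"
    by (simp_all add: m_def \<alpha>_def)
  have lower: "N * ((1 - x) * P)
      = (of_int n + of_int k + b + c + 1) * shifted_jacobi m (\<alpha> - 1) a x
        - (of_int n - of_int k + 1) * shifted_jacobi (m + 1) (\<alpha> - 1) a x"
    using shifted_jacobi_times_one_minus_x[OF m0, of \<alpha> a x] unfolding N_eq coeffs P_def .
  have raise: "N * P
      = (of_int n + of_int k + a + b + c + 2) * shifted_jacobi m (\<alpha> + 1) a x
        - (of_int n - of_int k + a) * shifted_jacobi (m - 1) (\<alpha> + 1) a x"
    using shifted_jacobi_raise[OF m0, of \<alpha> a x] unfolding N_eq coeffs(2,3) P_def .
  have times_w: "\<alpha> * (w * Q) = (of_int k + b) * shifted_jacobi k c (b - 1) w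
      + (of_int k + 1) * shifted_jacobi (k + 1) c (b - 1) w"
    using shifted_jacobi_times_x[OF assms(1), of c b w] by (simp add: \<alpha>_def Q_def add_ac)
  have times_one_minus_w: "\<alpha> * ((1 - w) * Q) = (of_int k + c) * shifted_jacobi k (c - 1) b w
      - (of_int k + 1) * shifted_jacobi (k + 1) (c - 1) b w"
    using shifted_jacobi_times_one_minus_x[OF assms(1), of c b w]
    by (simp add: \<alpha>_def Q_def add_ac)
  have T: "triangle_jacobi n k a b c x y = P * q * Q"
    using assms(1) by (simp add: triangle_jacobi_eq P_def Q_def m_def \<alpha>_def w_def q_def)
  have T_a: "triangle_jacobi n k (a - 1) b c x y = shifted_jacobi m \<alpha> (a - 1) x * q * Q"
    "triangle_jacobi (n + 1) k (a - 1) b c x y = shifted_jacobi (m + 1) \<alpha> (a - 1) x * q * Q"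
    using assms(1)
    by (simp_all add: triangle_jacobi_eq Q_def m_def \<alpha>_def w_def q_def algebra_simps)
  \<comment> \<open>The first parameter depends on \<open>b\<close> and \<open>c\<close> only
    through their sum, so lowering either shifts it by -1; replacing \<open>k\<close> by
    \<open>k + 1\<close> adds 2, a net shift of +1.\<close>
  have T_bc: "triangle_jacobi n k a b' c' x y
        = shifted_jacobi m (\<alpha> - 1) a x * q * shifted_jacobi k c' b' w"
    "triangle_jacobi (n + 1) k a b' c' x y
        = shifted_jacobi (m + 1) (\<alpha> - 1) a x * q * shifted_jacobi k c' b' w"
    "triangle_jacobi n (k + 1) a b' c' x y
        = shifted_jacobi (m - 1) (\<alpha> + 1) a x * ((1 - x) * q) * shifted_jacobi (k + 1) c' b' w"
    "triangle_jacobi (n + 1) (k + 1) a b' c' x y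
        = shifted_jacobi m (\<alpha> + 1) a x * ((1 - x) * q) * shifted_jacobi (k + 1) c' b' w"
    if "b' + c' = b + c - 1" for b' c'
  proof -
    have "2 * of_int k + b' + c' + 1 = \<alpha> - 1" "2 * of_int (k + 1) + b' + c' + 1 = \<alpha> + 1"
      "n + 1 - k = m + 1" "n - (k + 1) = m - 1" "n + 1 - (k + 1) = m"
      using that by (simp_all add: \<alpha>_def m_def)
    then show "triangle_jacobi n k a b' c' x y
        = shifted_jacobi m (\<alpha> - 1) a x * q * shifted_jacobi k c' b' w"
      "triangle_jacobi (n + 1) k a b' c' x y
        = shifted_jacobi (m + 1) (\<alpha> - 1) a x * q * shifted_jacobi k c' b' w"
      "triangle_jacobi n (k + 1) a b' c' x y
        = shifted_jacobi (m - 1) (\<alpha> + 1) a x * ((1 - x) * q) * shifted_jacobi (k + 1) c' b' w"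
      "triangle_jacobi (n + 1) (k + 1) a b' c' x y
        = shifted_jacobi m (\<alpha> + 1) a x * ((1 - x) * q) * shifted_jacobi (k + 1) c' b' w"
      using assms(1) power
      by (simp_all only: triangle_jacobi_eq add_nonneg_nonneg zero_le_one
          m_def[symmetric] w_def[symmetric] q_def[symmetric])
  qed
  have "N * x * (P * q * Q) = (N * (x * P)) * q * Q"
    by simp
  also have "\<dots> = ((of_int n - of_int k + a) * shifted_jacobi m \<alpha> (a - 1) x
      + (of_int n - of_int k + 1) * shifted_jacobi (m + 1) \<alpha> (a - 1) x) * q * Q"
    using shifted_jacobi_times_x[OF m0, of \<alpha> a x] unfolding N_eq coeffs P_def by simp
  finally have 1: "N * x * (P * q * Q)
      = (of_int n - of_int k + a) * (shifted_jacobi m \<alpha> (a - 1) x * q * Q)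
        + (of_int n - of_int k + 1) * (shifted_jacobi (m + 1) \<alpha> (a - 1) x * q * Q)"
    by (simp add: algebra_simps)
  \<comment> \<open>With \<open>r\<close> equal to \<open>w\<close> or \<open>1 - w\<close> this
    serves both \<open>y\<close> and \<open>z\<close>. The brackets are the left sides of
    \<open>lower\<close> and \<open>raise\<close>, ready for rewriting.\<close>
  have split: "\<alpha> * N * ((1 - x) * r) * (P * q * Q)
      = (N * ((1 - x) * P)) * q * U + (N * P) * ((1 - x) * q) * V"
    if "\<alpha> * (r * Q) = U + V" for r U V
  proof -
    have "\<alpha> * N * ((1 - x) * r) * (P * q * Q) = N * ((1 - x) * P) * q * (\<alpha> * (r * Q))"
      by (simp only: mult_ac)
    then show ?thesis
      unfolding that by (simp add: distrib_left mult_ac)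
  qed
  have 2: "\<alpha> * N * y * (P * q * Q)
      = ((of_int n + of_int k + b + c + 1) * shifted_jacobi m (\<alpha> - 1) a x
          - (of_int n - of_int k + 1) * shifted_jacobi (m + 1) (\<alpha> - 1) a x) * q
          * ((of_int k + b) * shifted_jacobi k c (b - 1) w)
        + ((of_int n + of_int k + a + b + c + 2) * shifted_jacobi m (\<alpha> + 1) a x
          - (of_int n - of_int k + a) * shifted_jacobi (m - 1) (\<alpha> + 1) a x) * ((1 - x) * q)
          * ((of_int k + 1) * shifted_jacobi (k + 1) c (b - 1) w)"
    unfolding y split[OF times_w] lower raise ..
  have 3: "\<alpha> * N * z * (P * q * Q)
      = ((of_int n + of_int k + b + c + 1) * shifted_jacobi m (\<alpha> - 1) a x
          - (of_int n - of_int k + 1) * shifted_jacobi (m + 1) (\<alpha> - 1) a x) * q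
          * ((of_int k + c) * shifted_jacobi k (c - 1) b w)
        + ((of_int n + of_int k + a + b + c + 2) * shifted_jacobi m (\<alpha> + 1) a x
          - (of_int n - of_int k + a) * shifted_jacobi (m - 1) (\<alpha> + 1) a x) * ((1 - x) * q)
          * (- ((of_int k + 1) * shifted_jacobi (k + 1) (c - 1) b w))"
    unfolding z
    \<comment> \<open>The difference is turned into a sum with a negated term to match
      \<open>U + V\<close>.\<close>
    using split[OF times_one_minus_w[unfolded diff_conv_add_uminus[of "_ * _"]]]
    unfolding lower raise .
  have b: "(b - 1) + c = b + c - 1" and c: "b + (c - 1) = b + c - 1"
    by simp_all
  show ?thesis
    unfolding N_def[symmetric] \<alpha>_def[symmetric] T T_a T_bc[OF b] T_bc[OF c] 1 2 3
    by (intro conjI refl; algebra)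
qed

end
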